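(* Let $p\ge 1$ be an integer, $g>0$ with $g^2\ge p$, and let $\xi$ be a random vector in $\mathbb{R}^p$ such that $$\log \mathbb{E}\exp(\gamma^\top \xi)\le \|\gamma\|^2/2\qquad\text{for all }\gamma\in\mathbb{R}^p\text{ with }\|\gamma\|\le g .$$ Let $w_c,\mu_c,y_c,x_c,g_c$ be determined by $g$ and $p$ as in the context, and let $\kappa=6.6$. Then for $0\le x\le x_c$, $$\mathbb{P}\bigl(\|\xi\|^2\ge z(x,p)\bigr)\le 2e^{-x}+8.4\,e^{-x_c},\qquad z(x,p)=\begin{cases}p+\sqrt{\kappa x p}, & x\le p/\kappa,\\ p+\kappa x, & p/\kappa<x\le x_c,\end{cases}$$ and for $x>x_c$, $$\mathbb{P}\bigl(\|\xi\|^2\ge z_c(x,p)\bigr)\le 8.4\,e^{-x},\qquad z_c(x,p)=\bigl|y_c+2(x-x_c)/g_c\bigr|^2 .$$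
   Context: $\|\cdot\|$ is the Euclidean norm on $\mathbb{R}^p$. Given $g>0$ and $p$, the number $w_c>0$ is the unique positive solution of $$\frac{w_c(1+w_c)}{(1+w_c^2)^{1/2}}=g\,p^{-1/2},$$ and $$\mu_c=\frac{w_c^2}{1+w_c^2},\quad y_c=\sqrt{(1+w_c^2)\,p},\quad x_c=\tfrac12\,p\,\bigl[w_c^2-\log(1+w_c^2)\bigr],\quad g_c=g-\sqrt{\mu_c p}=\frac{g\,w_c}{1+w_c}.$$ *)

theory Defs
  imports "HOL-Probability.Probability"
begin

definition is_w_c :: "real \<Rightarrow> nat \<Rightarrow> real \<Rightarrow> bool" where
  "is_w_c g p w \<longleftrightarrow> w > 0 \<and> w * (1 + w) / sqrt (1 + w\<^sup>2) = g * real p powr (- 1 / 2)"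

definition w_c :: "real \<Rightarrow> nat \<Rightarrow> real" where
  "w_c g p = (THE w. is_w_c g p w)"

definition mu_c :: "real \<Rightarrow> nat \<Rightarrow> real" where
  "mu_c g p = (w_c g p)\<^sup>2 / (1 + (w_c g p)\<^sup>2)"

definition y_c :: "real \<Rightarrow> nat \<Rightarrow> real" where
  "y_c g p = sqrt ((1 + (w_c g p)\<^sup>2) * real p)"

definition x_c :: "real \<Rightarrow> nat \<Rightarrow> real" where
  "x_c g p = 1 / 2 * real p * ((w_c g p)\<^sup>2 - ln (1 + (w_c g p)\<^sup>2))"

definition g_c :: "real \<Rightarrow> nat \<Rightarrow> real" where
  "g_c g p = g - sqrt (mu_c g p * real p)"

definition kappa :: real where
  "kappa = 6.6"

definition z_quant :: "real \<Rightarrow> nat \<Rightarrow> real" where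
  "z_quant x p =
     (if x \<le> real p / kappa then real p + sqrt (kappa * x * real p)
      else real p + kappa * x)"

definition z_c :: "real \<Rightarrow> real \<Rightarrow> nat \<Rightarrow> real" where
  "z_c g x p = \<bar>y_c g p + 2 * (x - x_c g p) / g_c g p\<bar>\<^sup>2"

text \<open>
  A real-valued \<open>expectation\<close> is 0 for a non-integrable function and \<open>ln 0 = 0\<close>, so
  integrability is required explicitly: mathematically, the bound forces the exponential
  moment to be finite.
\<close>

definition (in prob_space) exp_moment_bound :: "real \<Rightarrow> ('a \<Rightarrow> real ^ 'n) \<Rightarrow> bool" where
  "exp_moment_bound g \<xi> \<longleftrightarrow>
     (\<forall>\<gamma>. norm \<gamma> \<le> g \<longrightarrow>
        integrable M (\<lambda>\<omega>. exp (\<gamma> \<bullet> \<xi> \<omega>)) \<and>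
        ln (expectation (\<lambda>\<omega>. exp (\<gamma> \<bullet> \<xi> \<omega>))) \<le> (norm \<gamma>)\<^sup>2 / 2)"

lemma w_c_fun_strict_mono:
  fixes v w :: real
  assumes "0 < v" "v < w"
  shows "v * (1 + v) / sqrt (1 + v\<^sup>2) < w * (1 + w) / sqrt (1 + w\<^sup>2)"
proof -
  have sq: "v\<^sup>2 < w\<^sup>2"
    using assms by (intro power_strict_mono) auto
  have "v\<^sup>2 * (1 + w\<^sup>2) \<le> w\<^sup>2 * (1 + v\<^sup>2)"
    using sq by (simp add: algebra_simps)
  then have "sqrt (v\<^sup>2 * (1 + w\<^sup>2)) \<le> sqrt (w\<^sup>2 * (1 + v\<^sup>2))"
    by (rule real_sqrt_le_mono)
  then have "v * sqrt (1 + w\<^sup>2) \<le> w * sqrt (1 + v\<^sup>2)"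
    using assms by (simp add: real_sqrt_mult)
  then have "(v * sqrt (1 + w\<^sup>2)) * (1 + v) < (w * sqrt (1 + v\<^sup>2)) * (1 + w)"
    using assms by (intro mult_le_less_imp_less) (auto simp: add_pos_nonneg)
  moreover have "sqrt (1 + v\<^sup>2) > 0" "sqrt (1 + w\<^sup>2) > 0"
    by (simp_all add: add_pos_nonneg)
  ultimately show ?thesis
    by (simp add: divide_less_eq less_divide_eq mult_ac)
qed

lemma ex1_w_c:
  fixes g :: real and p :: nat
  assumes "g > 0" "p \<ge> 1"
  shows "\<exists>!w. is_w_c g p w"
proof -
  define f :: "real \<Rightarrow> real" where "f = (\<lambda>w. w * (1 + w) / sqrt (1 + w\<^sup>2))"
  define c where "c = g * real p powr (- 1 / 2)"
  have c: "c > 0" using assms by (simp add: c_def)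
  have "sqrt (1 + c\<^sup>2) \<le> 1 + c"
    using c by (intro real_le_lsqrt) (auto simp: power2_eq_square algebra_simps)
  moreover have "sqrt (1 + c\<^sup>2) > 0"
    by (simp add: add_pos_nonneg)
  ultimately have "c \<le> f c"
    using c by (simp add: f_def le_divide_eq)
  moreover have "continuous_on {0..c} f"
    unfolding f_def by (intro continuous_intros) (auto simp: add_nonneg_eq_0_iff)
  moreover have "f 0 \<le> c" using c by (simp add: f_def)
  ultimately obtain w where w: "0 \<le> w" "f w = c"
    using IVT'[of f 0 c c] c by auto
  moreover have "w \<noteq> 0" using w c by (auto simp: f_def)
  ultimately have "is_w_c g p w"
    by (simp add: is_w_c_def f_def c_def)
  moreover have "v = w" if "is_w_c g p v" "is_w_c g p w" for v w
    using that w_c_fun_strict_mono[of v w] w_c_fun_strict_mono[of w v]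
    unfolding is_w_c_def by (cases v w rule: linorder_cases) auto
  ultimately show ?thesis by blast
qed

lemma is_w_c_w_c:
  assumes "g > 0" "p \<ge> 1"
  shows "is_w_c g p (w_c g p)"
  unfolding w_c_def by (rule theI') (rule ex1_w_c[OF assms])

lemma g_c_eq:
  assumes "g > 0" "p \<ge> 1"
  shows "g_c g p = g * w_c g p / (1 + w_c g p)"
proof -
  define w where "w = w_c g p"
  have w: "w > 0" "w * (1 + w) / sqrt (1 + w\<^sup>2) = g * real p powr (- 1 / 2)"
    using is_w_c_w_c[OF assms] by (simp_all add: is_w_c_def w_def)
  have "real p powr (- 1 / 2) = 1 / sqrt (real p)"
    using assms powr_minus_divide[of "real p" "1 / 2"] by (simp add: powr_half_sqrt)
  then have "w * (1 + w) / sqrt (1 + w\<^sup>2) * sqrt (real p) = g"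
    using w assms by simp
  moreover have "sqrt (mu_c g p * real p) = w / sqrt (1 + w\<^sup>2) * sqrt (real p)"
    using w by (simp add: mu_c_def w_def real_sqrt_mult real_sqrt_divide)
  ultimately have "sqrt (mu_c g p * real p) * (1 + w) = g"
    by (simp add: mult_ac)
  then have "sqrt (mu_c g p * real p) = g / (1 + w)"
    using w by (simp add: eq_divide_eq)
  then show ?thesis
    using w by (simp add: g_c_def w_def[symmetric] divide_simps) (simp add: algebra_simps)
qed

end

theory Submission
  imports Defs "HOL-Real_Asymp.Real_Asymp"
begin

text \<open>
  The idea is to average \<open>exp (\<gamma> \<bullet> \<xi>)\<close> over \<open>\<parallel>\<gamma>\<parallel> \<le> g\<close> with the Gaussian weight
  \<open>exp (- \<parallel>\<gamma>\<parallel>\<^sup>2 / (2 * \<mu>))\<close>. By Tonelli the moment condition bounds the expectation of this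
  average by a full Gaussian integral. Conversely, restricting the integral to the ball of radius
  \<open>sqrt (\<mu> * p)\<close> around a centre \<open>b\<close> with \<open>\<parallel>b\<parallel> + sqrt (\<mu> * p) \<le> g\<close> bounds the average from below
  by \<open>exp (b \<bullet> \<xi> - \<parallel>b\<parallel>\<^sup>2 / (2 * \<mu>))\<close> times the Gaussian mass of that ball, which is at least half of
  the total mass because the median of a \<open>\<chi>\<^sup>2\<close> variable does not exceed its mean. The centre
  \<open>b = \<mu> \<xi>\<close> handles \<open>\<parallel>\<xi>\<parallel> \<le> y\<^sub>c\<close>, and \<open>b = g\<^sub>c \<xi> / \<parallel>\<xi>\<parallel>\<close>, \<open>\<mu> = \<mu>\<^sub>c\<close> handles
  \<open>\<parallel>\<xi>\<parallel> \<ge> y\<^sub>c\<close>; Markov's inequality does the rest.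
\<close>

subsection \<open>The median of a Gamma variable\<close>

text \<open>The logarithm \<open>D\<close> of the ratio of the two densities starts at 0, decreases
  while \<open>a * s\<^sup>2 < 1\<close> and increases afterwards, so it changes sign at most once,
  from nonpositive to positive. The crossing point is the supremum of the set where
  \<open>D s \<le> 0\<close>; it is 1 when \<open>a \<le> 1\<close>.\<close>

lemma gamma_density_single_crossing:
  fixes a :: real
  assumes "a > 0"
  obtains s0 where "0 < s0" "s0 \<le> 1"
    "\<And>s. 0 < s \<Longrightarrow> s < s0 \<Longrightarrow>
       (1 + s) powr (a - 1) * exp (- a * s) \<le> (1 - s) powr (a - 1) * exp (a * s)"
    "\<And>s. s0 < s \<Longrightarrow> s < 1 \<Longrightarrow>
       (1 - s) powr (a - 1) * exp (a * s) \<le> (1 + s) powr (a - 1) * exp (- a * s)"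
proof -
  define D where "D s = (a - 1) * (ln (1 + s) - ln (1 - s)) - 2 * a * s" for s :: real
  have D: "(D has_real_derivative 2 * (a * s\<^sup>2 - 1) / (1 - s\<^sup>2)) (at s)" if "0 \<le> s" "s < 1" for s
  proof -
    have "1 - s\<^sup>2 \<noteq> 0" using that by (simp add: power2_eq_1_iff)
    then show ?thesis
      unfolding D_def using that
      by (auto intro!: derivative_eq_intros simp: divide_simps) (auto simp: algebra_simps power2_eq_square)
  qed
  have pos: "1 - s\<^sup>2 > 0" if "0 \<le> s" "s < 1" for s :: real
    using that by (simp add: abs_square_less_1)
  define s1 where "s1 = 1 / sqrt a"
  have s1: "s1 > 0" "a * s1\<^sup>2 = 1" using assms by (simp_all add: s1_def power_divide)
  have dec: "D s \<le> 0" if "0 \<le> s" "s < 1" "s \<le> s1" for s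
  proof -
    have "D s \<le> D 0"
    proof (rule DERIV_nonpos_imp_nonincreasing[OF that(1)])
      fix t assume t: "0 \<le> t" "t \<le> s"
      have "a * t\<^sup>2 \<le> a * s1\<^sup>2"
        using t that assms by (intro mult_left_mono power_mono) auto
      then show "\<exists>y. (D has_real_derivative y) (at t) \<and> y \<le> 0"
        using D[of t] pos[of t] t that s1 by (intro exI conjI) (auto simp: divide_le_0_iff)
    qed
    then show ?thesis by (simp add: D_def)
  qed
  have inc: "D s \<le> D t" if "s1 \<le> s" "s \<le> t" "t < 1" for s t
  proof (rule DERIV_nonneg_imp_nondecreasing[OF that(2)])
    fix r assume r: "s \<le> r" "r \<le> t"
    have "a * s1\<^sup>2 \<le> a * r\<^sup>2"
      using r that assms s1 by (intro mult_left_mono power_mono) auto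
    then show "\<exists>y. (D has_real_derivative y) (at r) \<and> 0 \<le> y"
      using D[of r] pos[of r] r that s1 by (intro exI conjI) (auto simp: zero_le_divide_iff)
  qed
  define S where "S = {s. 0 \<le> s \<and> s < 1 \<and> D s \<le> 0}"
  have bdd: "bdd_above S" by (rule bdd_aboveI[of _ 1]) (auto simp: S_def)
  \<comment> \<open>The turning point \<open>s1\<close> may lie at or beyond 1, hence the minimum.
    This element of \<open>S\<close> makes \<open>Sup S\<close> positive.\<close>
  have mem: "min s1 1 / 2 \<in> S" using dec[of "min s1 1 / 2"] s1 by (auto simp: S_def)
  have le: "(1 + s) powr (a - 1) * exp (- a * s) \<le> (1 - s) powr (a - 1) * exp (a * s) \<longleftrightarrow> D s \<le> 0"
    "(1 - s) powr (a - 1) * exp (a * s) \<le> (1 + s) powr (a - 1) * exp (- a * s) \<longleftrightarrow> 0 \<le> D s"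
    if "0 < s" "s < 1" for s
    using that by (auto simp: powr_def D_def exp_add[symmetric] algebra_simps)
  show thesis
  proof (rule that[of "Sup S"])
    have "min s1 1 / 2 > 0" using s1 by simp
    then show Sup_pos: "Sup S > 0" using cSup_upper[OF mem bdd] by linarith
    have "S \<noteq> {}" using mem by blast
    then show "Sup S \<le> 1" by (rule cSup_least) (simp add: S_def)
    fix s :: real
    {
      assume s: "0 < s" "s < Sup S"
      then obtain t where t: "t \<in> S" "s < t"
        using mem less_cSup_iff[of S s] bdd by auto
      have "D s \<le> 0"
      proof (cases "s \<le> s1")
        case True
        then show ?thesis using dec[of s] s t by (auto simp: S_def)
      next
        case False
        then show ?thesis using inc[of s t] t by (auto simp: S_def)
      qed
      then show "(1 + s) powr (a - 1) * exp (- a * s) \<le> (1 - s) powr (a - 1) * exp (a * s)"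
        using le s t by (auto simp: S_def)
    }
    {
      assume s: "Sup S < s" "s < 1"
      moreover have "0 < s" using s Sup_pos by simp
      moreover have "s \<notin> S" using s cSup_upper[OF _ bdd, of s] by force
      ultimately show "(1 - s) powr (a - 1) * exp (a * s) \<le> (1 + s) powr (a - 1) * exp (- a * s)"
        using le[of s] by (auto simp: S_def)
    }
  qed
qed

text \<open>The factor \<open>s\<close> makes the integrand an exact derivative, that of
  \<open>- ((1 + s) powr a * exp (- a * s) / a)\<close>.\<close>

lemma gamma_upper_first_moment:
  fixes a :: real
  assumes "a > 0"
  shows "(\<integral>\<^sup>+s. ennreal (s * ((1 + s) powr (a - 1) * exp (- a * s))) * indicator {0..} s \<partial>lborel)
    = ennreal (1 / a)"
proof -
  have "(\<integral>\<^sup>+s. ennreal (s * ((1 + s) powr (a - 1) * exp (- a * s))) * indicator {0..} s \<partial>lborel)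
     = ennreal (0 - (- ((1 + 0) powr a * exp (- a * 0) / a)))"
  proof (rule nn_integral_FTC_atLeast)
    fix s :: real assume s: "0 \<le> s"
    have p: "(1 + s) powr a = (1 + s) * (1 + s) powr (a - 1)"
      using powr_mult_base[of "1 + s" "a - 1"] s by simp
    have "((\<lambda>s. (1 + s) powr a * exp (- a * s)) has_real_derivative
       a * (1 + s) powr (a - 1) * exp (- a * s) + (1 + s) powr a * (exp (- a * s) * (- a))) (at s)"
      using s by (auto intro!: derivative_eq_intros)
    from DERIV_cdivide[OF DERIV_minus[OF this], of a]
    show "((\<lambda>s. - ((1 + s) powr a * exp (- a * s) / a)) has_real_derivative
        s * ((1 + s) powr (a - 1) * exp (- a * s))) (at s)"
      using assms unfolding p by (simp add: field_simps)
    show "0 \<le> s * ((1 + s) powr (a - 1) * exp (- a * s))" using s by simp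
  next
    show "((\<lambda>s. - ((1 + s) powr a * exp (- a * s) / a)) \<longlongrightarrow> 0) at_top"
      using assms by real_asymp
  qed measurable
  then show ?thesis by simp
qed

text \<open>The antiderivative is that of the upper part reflected in the origin. The common value
  \<open>1 / a\<close> expresses that the deviation from the mean averages to zero.\<close>

lemma gamma_lower_first_moment:
  fixes a :: real
  assumes "a > 0"
  shows "(\<integral>\<^sup>+s. ennreal (s * ((1 - s) powr (a - 1) * exp (a * s))) * indicator {0..1} s \<partial>lborel)
    = ennreal (1 / a)"
proof (rule nn_integral_has_integral_lebesgue')
  define F where "F s = - ((1 - s) powr a * exp (a * s) / a)" for s
  have "((\<lambda>s. s * ((1 - s) powr (a - 1) * exp (a * s))) has_integral (F 1 - F 0)) {0..1}"
  \<comment> \<open>For \<open>a < 1\<close> the integrand is unbounded near 1, so the derivative is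
    taken only inside the interval, while \<open>F\<close> stays continuous up to the
    endpoints.\<close>
  proof (rule fundamental_theorem_of_calculus_interior)
    show "continuous_on {0..1} F"
      unfolding F_def using assms by (intro continuous_intros continuous_on_powr') auto
    fix s :: real assume s: "s \<in> {0<..<1}"
    have p: "(1 - s) powr a = (1 - s) * (1 - s) powr (a - 1)"
      using powr_mult_base[of "1 - s" "a - 1"] s by simp
    have "((\<lambda>s. (1 - s) powr a * exp (a * s)) has_real_derivative
       (a * (1 - s) powr (a - 1) * (-1)) * exp (a * s) + (1 - s) powr a * (exp (a * s) * a)) (at s)"
      using s by (auto intro!: derivative_eq_intros)
    from DERIV_cdivide[OF DERIV_minus[OF this], of a]
    have "(F has_real_derivative s * ((1 - s) powr (a - 1) * exp (a * s))) (at s)"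
      using assms unfolding p F_def by (simp add: field_simps)
    then show "(F has_vector_derivative s * ((1 - s) powr (a - 1) * exp (a * s))) (at s)"
      by (simp add: has_real_derivative_iff_has_vector_derivative)
  qed simp
  then show "((\<lambda>s. s * ((1 - s) powr (a - 1) * exp (a * s))) has_integral (1 / a)) {0..1}"
    using assms by (simp add: F_def)
qed simp

text \<open>
  Here \<open>s\<close> is the relative deviation from the mean of a \<open>Gamma(a)\<close> variable. The upper and lower
  density cross once, at \<open>s0\<close>, so \<open>s - s0\<close> times their difference is nonnegative; since the
  first moments of both parts agree, this leaves a comparison of the masses.
\<close>
lemma gamma_median_le_mean:
  fixes a :: real
  assumes "a > 0"
  shows "(\<integral>\<^sup>+s. ennreal ((1 + s) powr (a - 1) * exp (- a * s)) * indicator {0<..} s \<partial>lborel)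
    \<le> (\<integral>\<^sup>+s. ennreal ((1 - s) powr (a - 1) * exp (a * s)) * indicator {0..1} s \<partial>lborel)"
    (is "(\<integral>\<^sup>+s. ?h s * _ s \<partial>lborel) \<le> (\<integral>\<^sup>+s. ?k s * _ s \<partial>lborel)")
proof -
  define u where "u s = (1 + s) powr (a - 1) * exp (- a * s) * indicator {0<..} s" for s :: real
  define v where "v s = (1 - s) powr (a - 1) * exp (a * s) * indicator {0..1} s" for s :: real
  have [measurable]: "u \<in> borel_measurable borel" "v \<in> borel_measurable borel"
    unfolding u_def v_def by measurable
  have nonneg: "0 \<le> u s" "0 \<le> v s" for s by (simp_all add: u_def v_def)
  obtain s0 where s0: "0 < s0" "s0 \<le> 1"
    and lt: "\<And>s. 0 < s \<Longrightarrow> s < s0 \<Longrightarrow>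
       (1 + s) powr (a - 1) * exp (- a * s) \<le> (1 - s) powr (a - 1) * exp (a * s)"
    and gt: "\<And>s. s0 < s \<Longrightarrow> s < 1 \<Longrightarrow>
       (1 - s) powr (a - 1) * exp (a * s) \<le> (1 + s) powr (a - 1) * exp (- a * s)"
    using gamma_density_single_crossing[OF assms] by blast
  \<comment> \<open>This is \<open>(s - s0) * (u s - v s) \<ge> 0\<close> for positive
    \<open>s\<close>, with the negative terms moved across so that both sides are nonnegative and
    can be integrated in \<open>ennreal\<close>.\<close>
  have mono: "s * indicator {0<..} s * v s + s0 * u s \<le> s * indicator {0<..} s * u s + s0 * v s" for s
  proof -
    consider "s \<le> 0" | "0 < s" "s < s0" | "s = s0" | "s0 < s" "s < 1" | "s0 < s" "1 \<le> s"
      by linarith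
    then show ?thesis
    proof cases
      case 2
      then have "(s0 - s) * u s \<le> (s0 - s) * v s"
        using lt[of s] s0 by (intro mult_left_mono) (auto simp: u_def v_def)
      then show ?thesis using 2 by (simp add: algebra_simps)
    next
      case 4
      then have "(s - s0) * v s \<le> (s - s0) * u s"
        using gt[of s] s0 by (intro mult_left_mono) (auto simp: u_def v_def)
      then show ?thesis using 4 s0 by (simp add: algebra_simps)
    next
      case 5
      \<comment> \<open>At \<open>s = 1\<close> this uses the convention that
        \<open>0 powr x\<close> is 0 for every \<open>x\<close>.\<close>
      then have "v s = 0" by (cases "s = 1") (auto simp: v_def)
      moreover have "s0 * u s \<le> s * u s" using 5 nonneg by (intro mult_right_mono) auto
      ultimately show ?thesis using 5 s0 by simp
    qed (use s0 nonneg in \<open>auto simp: u_def\<close>)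
  qed
  have mu: "(\<integral>\<^sup>+s. ennreal (s * indicator {0<..} s * u s) \<partial>lborel) = ennreal (1 / a)"
    unfolding gamma_upper_first_moment[OF assms, symmetric]
    by (rule nn_integral_cong) (auto simp: u_def indicator_def)
  have mv: "(\<integral>\<^sup>+s. ennreal (s * indicator {0<..} s * v s) \<partial>lborel) = ennreal (1 / a)"
    unfolding gamma_lower_first_moment[OF assms, symmetric]
    by (rule nn_integral_cong) (auto simp: v_def indicator_def)
  have split: "(\<integral>\<^sup>+s. ennreal (s * indicator {0<..} s * f s + s0 * k s) \<partial>lborel) =
      (\<integral>\<^sup>+s. ennreal (s * indicator {0<..} s * f s) \<partial>lborel) + s0 * (\<integral>\<^sup>+s. ennreal (k s) \<partial>lborel)"
    if [measurable]: "f \<in> borel_measurable borel" "k \<in> borel_measurable borel"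
      and "\<And>s. 0 \<le> f s" "\<And>s. 0 \<le> k s" for f k
  proof -
    have "(\<integral>\<^sup>+s. ennreal (s * indicator {0<..} s * f s + s0 * k s) \<partial>lborel) =
      (\<integral>\<^sup>+s. ennreal (s * indicator {0<..} s * f s) + ennreal s0 * ennreal (k s) \<partial>lborel)"
      using that s0 by (intro nn_integral_cong) (auto simp: ennreal_plus ennreal_mult indicator_def)
    also have "\<dots> = (\<integral>\<^sup>+s. ennreal (s * indicator {0<..} s * f s) \<partial>lborel)
        + s0 * (\<integral>\<^sup>+s. ennreal (k s) \<partial>lborel)"
      by (subst nn_integral_add) (auto simp: nn_integral_cmult)
    finally show ?thesis .
  qed
  have "(\<integral>\<^sup>+s. ennreal (s * indicator {0<..} s * v s + s0 * u s) \<partial>lborel)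
      \<le> (\<integral>\<^sup>+s. ennreal (s * indicator {0<..} s * u s + s0 * v s) \<partial>lborel)"
    by (intro nn_integral_mono ennreal_leI mono)
  then have "ennreal (1 / a) + s0 * (\<integral>\<^sup>+s. ennreal (u s) \<partial>lborel)
      \<le> ennreal (1 / a) + s0 * (\<integral>\<^sup>+s. ennreal (v s) \<partial>lborel)"
    by (simp add: split nonneg mu mv)
  then have "ennreal s0 * (\<integral>\<^sup>+s. ennreal (u s) \<partial>lborel) \<le> s0 * (\<integral>\<^sup>+s. ennreal (v s) \<partial>lborel)"
    by (simp add: ennreal_add_left_cancel_le)
  then have "(\<integral>\<^sup>+s. ennreal (u s) \<partial>lborel) \<le> (\<integral>\<^sup>+s. ennreal (v s) \<partial>lborel)"
    using s0 by (subst (asm) ennreal_mult_le_mult_iff) auto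
  moreover have "ennreal (u s) = ?h s * indicator {0<..} s" "ennreal (v s) = ?k s * indicator {0..1} s" for s
    by (auto simp: u_def v_def indicator_def)
  ultimately show ?thesis by simp
qed

subsection \<open>The Gaussian mass of a ball\<close>

text \<open>The sign makes the sets \<open>{c<..}\<close> of finite measure, as \<open>measure_eqI_lessThan\<close> requires.\<close>
lemma distr_uminus_sqnorm_lborel:
  "distr lborel borel (\<lambda>x::'a::euclidean_space. - (norm x)\<^sup>2) =
    density lborel (\<lambda>t. ennreal (unit_ball_vol DIM('a) * (DIM('a) / 2) * (- t) powr (DIM('a) / 2 - 1))
      * indicator {..<0} t)"
    (is "?M = ?N")
proof (rule measure_eqI_lessThan)
  define a where "a = real DIM('a) / 2"
  define V where "V = unit_ball_vol (real DIM('a))"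
  have a: "a > 0" by (simp add: a_def)
  have V: "V \<ge> 0" by (simp add: V_def)
  have M: "emeasure ?M {c<..} = (if c < 0 then ennreal (V * (- c) powr a) else 0)" for c
  proof (cases "c < 0")
    case True
    have "norm x < sqrt (- c) \<longleftrightarrow> (norm x)\<^sup>2 < - c" for x :: 'a
      using real_sqrt_less_iff[of "(norm x)\<^sup>2" "- c"] by simp
    then have "(\<lambda>x::'a. - (norm x)\<^sup>2) -` {c<..} = ball 0 (sqrt (- c))"
      by auto
    moreover have "sqrt (- c) ^ DIM('a) = (- c) powr a"
      using True by (simp add: a_def powr_half_sqrt[symmetric] powr_powr powr_realpow[symmetric])
    ultimately show ?thesis
      using True by (simp add: emeasure_distr emeasure_ball V_def)
  next
    case False
    have "\<not> c < - (norm x)\<^sup>2" for x :: 'a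
      using False zero_le_power2[of "norm x"] by linarith
    then have "(\<lambda>x::'a. - (norm x)\<^sup>2) -` {c<..} = {}"
      by auto
    then show ?thesis using False by (simp add: emeasure_distr)
  qed
  show "emeasure ?M {c<..} < \<infinity>" for c by (simp add: M)
  show "emeasure ?M {c<..} = emeasure ?N {c<..}" for c
  proof (cases "c < 0")
    case True
    have "((\<lambda>s. V * (a * s powr (a - 1))) has_integral V * (a * ((- c) powr (a - 1 + 1) / (a - 1 + 1)))) {0..- c}"
      using a True by (intro has_integral_mult_right has_integral_powr_from_0) auto
    then have "((\<lambda>s. V * (a * s powr (a - 1))) has_integral V * (- c) powr a) {0<..<- c}"
      using a by (simp add: has_integral_Icc_iff_Ioo)
    then have *: "(\<integral>\<^sup>+s. ennreal (V * (a * s powr (a - 1))) * indicator {0<..<- c} s \<partial>lborel) = ennreal (V * (- c) powr a)"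
      using a V by (intro nn_integral_has_integral_lebesgue') auto
    have "emeasure ?N {c<..} = (\<integral>\<^sup>+t. ennreal (V * a * (- t) powr (a - 1)) * indicator {..<0} t * indicator {c<..} t \<partial>lborel)"
      by (subst emeasure_density) (auto simp: a_def V_def)
    also have "\<dots> = (\<integral>\<^sup>+s. ennreal (V * (a * s powr (a - 1))) * indicator {0<..<- c} s \<partial>lborel)"
      by (subst nn_integral_real_affine[where c = "-1" and t = 0])
        (auto intro!: nn_integral_cong simp: indicator_def mult_ac)
    finally show ?thesis using M[of c] True * by simp
  next
    case False
    have "emeasure ?N {c<..} = 0"
      using False by (subst emeasure_density) (auto simp: nn_integral_0_iff_AE indicator_def)
    then show ?thesis using M[of c] False by simp
  qed
qed auto

text \<open>Polar coordinates for radial functions, in the variable \<open>t\<close> for the squared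
  norm: the density is the derivative of the volume of the ball of radius
  \<open>sqrt t\<close>.\<close>

lemma nn_integral_sqnorm:
  fixes f :: "real \<Rightarrow> ennreal"
  assumes [measurable]: "f \<in> borel_measurable borel"
  shows "(\<integral>\<^sup>+x. f ((norm (x::'a::euclidean_space))\<^sup>2) \<partial>lborel) =
    (\<integral>\<^sup>+t. ennreal (unit_ball_vol DIM('a) * (DIM('a) / 2) * t powr (DIM('a) / 2 - 1))
      * indicator {0<..} t * f t \<partial>lborel)"
proof -
  have "(\<integral>\<^sup>+x. f ((norm (x::'a))\<^sup>2) \<partial>lborel) =
      (\<integral>\<^sup>+t. f (- t) \<partial>distr lborel borel (\<lambda>x::'a. - (norm x)\<^sup>2))"
    by (subst nn_integral_distr) auto
  also have "\<dots> = (\<integral>\<^sup>+t. ennreal (unit_ball_vol DIM('a) * (DIM('a) / 2) * (- t) powr (DIM('a) / 2 - 1))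
      * indicator {..<0} t * f (- t) \<partial>lborel)"
    by (subst distr_uminus_sqnorm_lborel, subst nn_integral_density) auto
  also have "\<dots> = (\<integral>\<^sup>+t. ennreal (unit_ball_vol DIM('a) * (DIM('a) / 2) * t powr (DIM('a) / 2 - 1))
      * indicator {0<..} t * f t \<partial>lborel)"
    by (subst nn_integral_real_affine[where c = "-1" and t = 0])
      (auto intro!: nn_integral_cong simp: indicator_def)
  finally show ?thesis .
qed

text \<open>Under the Gaussian weight the squared norm is chi-squared with \<open>n\<close> degrees
  of freedom, a scaled Gamma variable of shape \<open>n / 2\<close> with mean \<open>n\<close>. The
  substitutions \<open>t = n + n * s\<close> outside and \<open>t = n - n * s\<close> inside leave
  the same constant \<open>K\<close> in front of the two integrals compared in
  \<open>gamma_median_le_mean\<close>.\<close>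

lemma gaussian_outer_le_inner:
  "(\<integral>\<^sup>+x. ennreal (exp (- (norm (x::'a::euclidean_space))\<^sup>2 / 2)) * indicator {x. (norm x)\<^sup>2 > DIM('a)} x \<partial>lborel)
    \<le> (\<integral>\<^sup>+x. ennreal (exp (- (norm (x::'a))\<^sup>2 / 2)) * indicator {x. (norm x)\<^sup>2 \<le> DIM('a)} x \<partial>lborel)"
    (is "?out \<le> ?in")
proof -
  define n where "n = real DIM('a)"
  define a where "a = n / 2"
  define V where "V = unit_ball_vol (real DIM('a))"
  define K where "K = V * a * n powr (a - 1) * exp (- a) * n"
  have n: "n > 0" by (simp add: n_def)
  have a: "a > 0" using n by (simp add: a_def)
  have V: "V \<ge> 0" by (simp add: V_def)
  have K: "K \<ge> 0" using n a V by (simp add: K_def)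
  have e1: "ennreal n * (ennreal (V * a * (n + n * s) powr (a - 1)) * ennreal (exp (- (n + n * s) / 2)))
      = ennreal K * ennreal ((1 + s) powr (a - 1) * exp (- a * s))" if "s \<ge> -1" for s
  proof -
    have "(n + n * s) powr (a - 1) = n powr (a - 1) * (1 + s) powr (a - 1)"
      using powr_mult[of n "1 + s" "a - 1"] n that by (simp add: algebra_simps)
    moreover have "exp (- (n + n * s) / 2) = exp (- a) * exp (- a * s)"
      by (simp add: a_def exp_add[symmetric] field_simps)
    ultimately show ?thesis
      using n a V K by (simp add: K_def ennreal_mult[symmetric] mult_ac)
  qed
  have "?out = (\<integral>\<^sup>+x. (\<lambda>t. ennreal (exp (- t / 2)) * indicator {n<..} t) ((norm (x::'a))\<^sup>2) \<partial>lborel)"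
    by (intro nn_integral_cong) (simp add: indicator_def n_def)
  also have "\<dots> = (\<integral>\<^sup>+t. ennreal (V * a * t powr (a - 1)) * indicator {0<..} t *
      (ennreal (exp (- t / 2)) * indicator {n<..} t) \<partial>lborel)"
    by (subst nn_integral_sqnorm) (simp_all add: V_def a_def n_def)
  also have "\<dots> = ennreal n * (\<integral>\<^sup>+s. ennreal (V * a * (n + n * s) powr (a - 1)) * indicator {0<..} (n + n * s) *
      (ennreal (exp (- (n + n * s) / 2)) * indicator {n<..} (n + n * s)) \<partial>lborel)"
    using n by (subst nn_integral_real_affine[where c = n and t = n]) auto
  also have "\<dots> = (\<integral>\<^sup>+s. ennreal n * (ennreal (V * a * (n + n * s) powr (a - 1)) * indicator {0<..} (n + n * s) *
      (ennreal (exp (- (n + n * s) / 2)) * indicator {n<..} (n + n * s))) \<partial>lborel)"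
    by (rule nn_integral_cmult[symmetric]) measurable
  also have "\<dots> = (\<integral>\<^sup>+s. ennreal K * (ennreal ((1 + s) powr (a - 1) * exp (- a * s)) * indicator {0<..} s) \<partial>lborel)"
  proof (rule nn_integral_cong)
    fix s :: real
    have "n + n * s > 0" if "s > 0" using n that by (simp add: add_pos_pos)
    moreover have "n + n * s > n \<longleftrightarrow> s > 0" using n by (simp add: zero_less_mult_iff)
    ultimately show "ennreal n * (ennreal (V * a * (n + n * s) powr (a - 1)) * indicator {0<..} (n + n * s) *
      (ennreal (exp (- (n + n * s) / 2)) * indicator {n<..} (n + n * s)))
      = ennreal K * (ennreal ((1 + s) powr (a - 1) * exp (- a * s)) * indicator {0<..} s)"
      using e1[of s] by (cases "s > 0") (auto simp: indicator_def)
  qed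
  also have "\<dots> = ennreal K * (\<integral>\<^sup>+s. ennreal ((1 + s) powr (a - 1) * exp (- a * s)) * indicator {0<..} s \<partial>lborel)"
    by (rule nn_integral_cmult) measurable
  also have "\<dots> \<le> ennreal K * (\<integral>\<^sup>+s. ennreal ((1 - s) powr (a - 1) * exp (a * s)) * indicator {0..1} s \<partial>lborel)"
    by (intro mult_left_mono gamma_median_le_mean a) auto
  also have "\<dots> = (\<integral>\<^sup>+s. ennreal K * (ennreal ((1 - s) powr (a - 1) * exp (a * s)) * indicator {0..1} s) \<partial>lborel)"
    by (rule nn_integral_cmult[symmetric]) measurable
  also have "\<dots> = (\<integral>\<^sup>+s. ennreal n * (ennreal (V * a * (n + (- n) * s) powr (a - 1)) * indicator {0<..} (n + (- n) * s) *
      (ennreal (exp (- (n + (- n) * s) / 2)) * indicator {..n} (n + (- n) * s))) \<partial>lborel)"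
  proof (rule nn_integral_cong)
    fix s :: real
    have "n + (- n) * s > 0 \<longleftrightarrow> s < 1" using n by simp
    moreover have "n + (- n) * s \<le> n \<longleftrightarrow> s \<ge> 0" using n by (simp add: zero_le_mult_iff)
    ultimately show "ennreal K * (ennreal ((1 - s) powr (a - 1) * exp (a * s)) * indicator {0..1} s) =
      ennreal n * (ennreal (V * a * (n + (- n) * s) powr (a - 1)) * indicator {0<..} (n + (- n) * s) *
      (ennreal (exp (- (n + (- n) * s) / 2)) * indicator {..n} (n + (- n) * s)))"
      \<comment> \<open>At \<open>s = 1\<close> both sides vanish: the right by its strict indicator
        at 0, the left because \<open>0 powr (a - 1)\<close> is 0.\<close>
      using e1[of "- s"] by (cases "s = 1") (auto simp: indicator_def)
  qed
  also have "\<dots> = ennreal n * (\<integral>\<^sup>+s. ennreal (V * a * (n + (- n) * s) powr (a - 1)) * indicator {0<..} (n + (- n) * s) *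
      (ennreal (exp (- (n + (- n) * s) / 2)) * indicator {..n} (n + (- n) * s)) \<partial>lborel)"
    by (rule nn_integral_cmult) measurable
  also have "\<dots> = (\<integral>\<^sup>+t. ennreal (V * a * t powr (a - 1)) * indicator {0<..} t *
      (ennreal (exp (- t / 2)) * indicator {..n} t) \<partial>lborel)"
    using n by (subst nn_integral_real_affine[where c = "- n" and t = n and f = "\<lambda>t. ennreal (V * a * t powr (a - 1)) * indicator {0<..} t *
      (ennreal (exp (- t / 2)) * indicator {..n} t)"]) auto
  also have "\<dots> = (\<integral>\<^sup>+x. (\<lambda>t. ennreal (exp (- t / 2)) * indicator {..n} t) ((norm (x::'a))\<^sup>2) \<partial>lborel)"
    by (subst nn_integral_sqnorm) (simp_all add: V_def a_def n_def)
  also have "\<dots> = ?in"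
    by (intro nn_integral_cong) (simp add: indicator_def n_def)
  finally show ?thesis .
qed

text \<open>The mass is left unnormalised, since it appears as a factor in both the lower and the
  upper bound on the averaged exponential and cancels. Positivity and finiteness, shown below,
  justify the cancellation.\<close>

definition gauss_ball :: "'a::euclidean_space itself \<Rightarrow> ennreal" where
  "gauss_ball _ = (\<integral>\<^sup>+x. ennreal (exp (- (norm (x::'a))\<^sup>2 / 2)) * indicator {x. (norm x)\<^sup>2 \<le> DIM('a)} x \<partial>lborel)"

lemma gaussian_integral_le_gauss_ball:
  "(\<integral>\<^sup>+x. ennreal (exp (- (norm (x::'a::euclidean_space))\<^sup>2 / 2)) \<partial>lborel) \<le> 2 * gauss_ball TYPE('a)"
proof -
  have "(\<integral>\<^sup>+x. ennreal (exp (- (norm (x::'a))\<^sup>2 / 2)) \<partial>lborel)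
    = (\<integral>\<^sup>+x. ennreal (exp (- (norm (x::'a))\<^sup>2 / 2)) * indicator {x. (norm x)\<^sup>2 > DIM('a)} x
       + ennreal (exp (- (norm (x::'a))\<^sup>2 / 2)) * indicator {x. (norm x)\<^sup>2 \<le> DIM('a)} x \<partial>lborel)"
    by (intro nn_integral_cong) (auto simp: indicator_def)
  also have "\<dots> \<le> gauss_ball TYPE('a) + gauss_ball TYPE('a)"
    using gaussian_outer_le_inner[where 'a = 'a]
    by (subst nn_integral_add) (auto simp: gauss_ball_def intro!: add_mono)
  finally show ?thesis by (simp add: mult_2)
qed

lemma gauss_ball_pos: "gauss_ball TYPE('a::euclidean_space) > 0"
proof -
  have "0 < exp (- real DIM('a) / 2) * (unit_ball_vol DIM('a) * sqrt (real DIM('a)) ^ DIM('a))"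
    by simp
  then have "0 < ennreal (exp (- real DIM('a) / 2)) * emeasure lborel (cball (0::'a) (sqrt DIM('a)))"
    by (simp add: emeasure_cball ennreal_mult[symmetric])
  also have "\<dots> = (\<integral>\<^sup>+x. ennreal (exp (- real DIM('a) / 2)) * indicator (cball (0::'a) (sqrt DIM('a))) x \<partial>lborel)"
    by (subst nn_integral_cmult_indicator) auto
  also have "\<dots> \<le> gauss_ball TYPE('a)"
    unfolding gauss_ball_def
    by (intro nn_integral_mono) (auto simp: indicator_def real_le_rsqrt real_sqrt_le_iff sqrt_ge_absD)
  finally show ?thesis .
qed

lemma gauss_ball_finite: "gauss_ball TYPE('a::euclidean_space) < \<infinity>"
proof -
  have "gauss_ball TYPE('a) \<le> (\<integral>\<^sup>+x. 1 * indicator (cball (0::'a) (sqrt DIM('a))) x \<partial>lborel)"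
    unfolding gauss_ball_def
    by (intro nn_integral_mono) (auto simp: indicator_def real_le_rsqrt)
  also have "\<dots> = emeasure lborel (cball (0::'a) (sqrt DIM('a)))"
    by (subst nn_integral_cmult_indicator) auto
  also have "\<dots> < \<infinity>" by (simp add: emeasure_cball)
  finally show ?thesis .
qed

subsection \<open>Averaging exponential moments\<close>

lemma nn_integral_lborel_affine:
  fixes f :: "'a::euclidean_space \<Rightarrow> ennreal"
  assumes [measurable]: "f \<in> borel_measurable borel" and c: "c > 0"
  shows "(\<integral>\<^sup>+x. f x \<partial>lborel) = ennreal (c ^ DIM('a)) * (\<integral>\<^sup>+x. f (t + c *\<^sub>R x) \<partial>lborel)"
  using c by (subst lborel_affine[of c t])
    (auto simp: nn_integral_density nn_integral_distr nn_integral_cmult)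

text \<open>Averaging the integrand over \<open>x\<close> and \<open>- x\<close> replaces the
  exponential by the hyperbolic cosine of \<open>x \<bullet> v\<close>, which is at least 1.\<close>

lemma nn_integral_even_le_exp_tilt:
  fixes w :: "'a::euclidean_space \<Rightarrow> ennreal"
  assumes [measurable]: "w \<in> borel_measurable borel" and even: "\<And>x. w (- x) = w x"
  shows "(\<integral>\<^sup>+x. w x \<partial>lborel) \<le> (\<integral>\<^sup>+x. ennreal (exp (x \<bullet> v)) * w x \<partial>lborel)" (is "?l \<le> ?r")
proof -
  have "?r = (\<integral>\<^sup>+x. ennreal (exp (- (x \<bullet> v))) * w x \<partial>lborel)"
    by (subst lborel_affine[of "-1" 0]) (simp_all add: nn_integral_density nn_integral_distr even)
  then have "2 * ?r = ?r + (\<integral>\<^sup>+x. ennreal (exp (- (x \<bullet> v))) * w x \<partial>lborel)"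
    by (simp add: mult_2)
  also have "\<dots> = (\<integral>\<^sup>+x. ennreal (exp (x \<bullet> v)) * w x + ennreal (exp (- (x \<bullet> v))) * w x \<partial>lborel)"
    by (subst nn_integral_add) auto
  also have "\<dots> \<ge> (\<integral>\<^sup>+x. 2 * w x \<partial>lborel)"
  proof (rule nn_integral_mono)
    fix x :: 'a
    have "2 \<le> exp (x \<bullet> v) + exp (- (x \<bullet> v))"
      using exp_ge_add_one_self[of "x \<bullet> v"] exp_ge_add_one_self[of "- (x \<bullet> v)"] by linarith
    then have "ennreal 2 \<le> ennreal (exp (x \<bullet> v) + exp (- (x \<bullet> v)))"
      by (rule ennreal_leI)
    also have "\<dots> = ennreal (exp (x \<bullet> v)) + ennreal (exp (- (x \<bullet> v)))"
      by (rule ennreal_plus) auto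
    finally have "2 \<le> ennreal (exp (x \<bullet> v)) + ennreal (exp (- (x \<bullet> v)))"
      by simp
    from mult_right_mono[OF this, of "w x"]
    show "2 * w x \<le> ennreal (exp (x \<bullet> v)) * w x + ennreal (exp (- (x \<bullet> v))) * w x"
      by (simp add: distrib_right)
  qed
  finally have "2 * ?l \<le> 2 * ?r" by (simp add: nn_integral_cmult)
  then show ?thesis
    using ennreal_mult_le_mult_iff[of 2 ?l ?r] by simp
qed

text \<open>The cutoff keeps exactly the \<gamma> to which the moment condition applies. Values in
  \<open>ennreal\<close> let Tonelli be used before finiteness is known.\<close>

definition tilt_integral :: "real \<Rightarrow> real \<Rightarrow> 'a::euclidean_space \<Rightarrow> ennreal" where
  "tilt_integral g \<mu> z =
    (\<integral>\<^sup>+\<gamma>. ennreal (exp (\<gamma> \<bullet> z - (norm \<gamma>)\<^sup>2 / (2 * \<mu>))) * indicator {\<gamma>. norm \<gamma> \<le> g} \<gamma> \<partial>lborel)"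

text \<open>After substituting \<open>b + sqrt \<mu> *\<^sub>R x\<close> for \<gamma>, the exponent
  is \<open>b \<bullet> z - (norm b)\<^sup>2 / (2 * \<mu>) + x \<bullet> v - (norm x)\<^sup>2 /
  2\<close>. The hypothesis on \<open>b\<close> keeps the points with
  \<open>(norm x)\<^sup>2 \<le> DIM('a)\<close> inside the cutoff, and by symmetry the linear term
  \<open>x \<bullet> v\<close> can only increase the integral over that ball.\<close>

lemma tilt_integral_lower:
  fixes b z :: "'a::euclidean_space" and \<mu> :: real
  assumes \<mu>: "\<mu> > 0" and b: "norm b + sqrt (\<mu> * DIM('a)) \<le> g"
  shows "ennreal (exp (b \<bullet> z - (norm b)\<^sup>2 / (2 * \<mu>)) * sqrt \<mu> ^ DIM('a)) * gauss_ball TYPE('a)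
    \<le> tilt_integral g \<mu> z"
proof -
  define v where "v = sqrt \<mu> *\<^sub>R z - b /\<^sub>R sqrt \<mu>"
  define E where "E = exp (b \<bullet> z - (norm b)\<^sup>2 / (2 * \<mu>))"
  define w :: "'a \<Rightarrow> ennreal"
    where "w x = ennreal (exp (- (norm x)\<^sup>2 / 2)) * indicator {x. (norm x)\<^sup>2 \<le> DIM('a)} x" for x
  have [measurable]: "w \<in> borel_measurable borel" unfolding w_def by measurable
  have "gauss_ball TYPE('a) \<le> (\<integral>\<^sup>+x. ennreal (exp (x \<bullet> v)) * w x \<partial>lborel)"
    unfolding gauss_ball_def w_def[symmetric]
    by (rule nn_integral_even_le_exp_tilt) (auto simp: w_def indicator_def)
  then have "ennreal (sqrt \<mu> ^ DIM('a)) * (ennreal E * gauss_ball TYPE('a))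
      \<le> ennreal (sqrt \<mu> ^ DIM('a)) * (ennreal E * (\<integral>\<^sup>+x. ennreal (exp (x \<bullet> v)) * w x \<partial>lborel))"
    by (intro mult_left_mono) auto
  moreover have "ennreal (E * sqrt \<mu> ^ DIM('a)) * gauss_ball TYPE('a)
      = ennreal (sqrt \<mu> ^ DIM('a)) * (ennreal E * gauss_ball TYPE('a))"
    using \<mu> by (simp add: E_def ennreal_mult mult_ac)
  ultimately have "ennreal (E * sqrt \<mu> ^ DIM('a)) * gauss_ball TYPE('a)
      \<le> ennreal (sqrt \<mu> ^ DIM('a)) * (ennreal E * (\<integral>\<^sup>+x. ennreal (exp (x \<bullet> v)) * w x \<partial>lborel))"
    by simp
  also have "\<dots> = ennreal (sqrt \<mu> ^ DIM('a)) * (\<integral>\<^sup>+x. ennreal E * (ennreal (exp (x \<bullet> v)) * w x) \<partial>lborel)"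
    by (simp add: nn_integral_cmult)
  also have "\<dots> \<le> ennreal (sqrt \<mu> ^ DIM('a)) * (\<integral>\<^sup>+x. ennreal (exp ((b + sqrt \<mu> *\<^sub>R x) \<bullet> z - (norm (b + sqrt \<mu> *\<^sub>R x))\<^sup>2 / (2 * \<mu>)))
      * indicator {\<gamma>. norm \<gamma> \<le> g} (b + sqrt \<mu> *\<^sub>R x) \<partial>lborel)"
  proof (intro mult_left_mono nn_integral_mono)
    fix x :: 'a
    show "ennreal E * (ennreal (exp (x \<bullet> v)) * w x) \<le>
      ennreal (exp ((b + sqrt \<mu> *\<^sub>R x) \<bullet> z - (norm (b + sqrt \<mu> *\<^sub>R x))\<^sup>2 / (2 * \<mu>)))
      * indicator {\<gamma>. norm \<gamma> \<le> g} (b + sqrt \<mu> *\<^sub>R x)"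
    proof (cases "(norm x)\<^sup>2 \<le> DIM('a)")
      case True
      then have "norm x \<le> sqrt DIM('a)" by (rule real_le_rsqrt)
      then have "sqrt \<mu> * norm x \<le> sqrt (\<mu> * DIM('a))"
        using \<mu> by (simp add: real_sqrt_mult mult_left_mono)
      then have "norm (b + sqrt \<mu> *\<^sub>R x) \<le> g"
        using b norm_triangle_ineq[of b "sqrt \<mu> *\<^sub>R x"] \<mu> by simp
      moreover have "(norm (b + sqrt \<mu> *\<^sub>R x))\<^sup>2 = (norm b)\<^sup>2 + 2 * sqrt \<mu> * (b \<bullet> x) + \<mu> * (norm x)\<^sup>2"
        using \<mu> by (simp add: power2_norm_eq_inner inner_simps inner_commute algebra_simps flip: power2_eq_square)
      then have "(b + sqrt \<mu> *\<^sub>R x) \<bullet> z - (norm (b + sqrt \<mu> *\<^sub>R x))\<^sup>2 / (2 * \<mu>)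
         = (b \<bullet> z - (norm b)\<^sup>2 / (2 * \<mu>)) + x \<bullet> v - (norm x)\<^sup>2 / 2"
        using \<mu> by (simp add: v_def inner_simps inner_commute real_div_sqrt field_simps)
      then have "exp ((b + sqrt \<mu> *\<^sub>R x) \<bullet> z - (norm (b + sqrt \<mu> *\<^sub>R x))\<^sup>2 / (2 * \<mu>))
         = E * (exp (x \<bullet> v) * exp (- (norm x)\<^sup>2 / 2))"
        by (simp add: E_def exp_add[symmetric])
      ultimately show ?thesis
        using True by (simp add: w_def E_def ennreal_mult)
    qed (simp add: w_def)
  qed simp
  also have "\<dots> = tilt_integral g \<mu> z"
    unfolding tilt_integral_def using \<mu>
    by (subst nn_integral_lborel_affine[where c = "sqrt \<mu>" and t = b]) auto
  finally show ?thesis unfolding E_def .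
qed

text \<open>Integrating over \<omega> first leaves the exponent \<open>(norm \<gamma>)\<^sup>2 / 2 -
  (norm \<gamma>)\<^sup>2 / (2 * \<mu>)\<close>, a centred Gaussian of variance
  \<open>\<mu> / (1 - \<mu>)\<close> because \<open>\<mu> < 1\<close>. The cutoff is then dropped,
  and the full Gaussian integral is at most twice the ball mass.\<close>

lemma (in prob_space) nn_integral_tilt_integral_upper:
  fixes \<xi> :: "'a \<Rightarrow> real ^ 'n" and \<mu> :: real
  assumes [measurable]: "\<xi> \<in> borel_measurable M"
    and bound: "exp_moment_bound g \<xi>" and \<mu>: "0 < \<mu>" "\<mu> < 1"
  shows "(\<integral>\<^sup>+\<omega>. tilt_integral g \<mu> (\<xi> \<omega>) \<partial>M)
    \<le> ennreal (2 * sqrt (\<mu> / (1 - \<mu>)) ^ CARD('n)) * gauss_ball TYPE(real ^ 'n)"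
proof -
  interpret pair_sigma_finite M "lborel :: (real ^ 'n) measure" ..
  define c where "c = sqrt (\<mu> / (1 - \<mu>))"
  have c: "c > 0" "c\<^sup>2 = \<mu> / (1 - \<mu>)" using \<mu> by (simp_all add: c_def)
  have mgf: "(\<integral>\<^sup>+\<omega>. ennreal (exp (\<gamma> \<bullet> \<xi> \<omega>)) \<partial>M) \<le> ennreal (exp ((norm \<gamma>)\<^sup>2 / 2))" if "norm \<gamma> \<le> g" for \<gamma>
  proof -
    let ?E = "expectation (\<lambda>\<omega>. exp (\<gamma> \<bullet> \<xi> \<omega>))"
    have "integrable M (\<lambda>\<omega>. exp (\<gamma> \<bullet> \<xi> \<omega>))" and ln: "ln ?E \<le> (norm \<gamma>)\<^sup>2 / 2"
      using bound that by (auto simp: exp_moment_bound_def)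
    then have "(\<integral>\<^sup>+\<omega>. ennreal (exp (\<gamma> \<bullet> \<xi> \<omega>)) \<partial>M) = ennreal ?E"
      by (intro nn_integral_eq_integral) auto
    also have "?E \<le> exp ((norm \<gamma>)\<^sup>2 / 2)"
    \<comment> \<open>\<open>exp_ln\<close> requires a positive argument; a nonpositive value would
      satisfy the bound trivially.\<close>
    proof (cases "?E > 0")
      case True
      then show ?thesis using ln by (metis exp_le_cancel_iff exp_ln)
    qed (use exp_ge_zero[of "(norm \<gamma>)\<^sup>2 / 2"] in linarith)
    finally show ?thesis by (simp add: ennreal_leI)
  qed
  have "(\<integral>\<^sup>+\<omega>. tilt_integral g \<mu> (\<xi> \<omega>) \<partial>M) =
    (\<integral>\<^sup>+\<gamma>. \<integral>\<^sup>+\<omega>. ennreal (exp (\<gamma> \<bullet> \<xi> \<omega> - (norm \<gamma>)\<^sup>2 / (2 * \<mu>))) * indicator {\<gamma>. norm \<gamma> \<le> g} \<gamma> \<partial>M \<partial>lborel)"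
    unfolding tilt_integral_def by (rule Fubini'[symmetric]) measurable
  also have "\<dots> \<le> (\<integral>\<^sup>+\<gamma>. ennreal (exp (- (norm \<gamma>)\<^sup>2 / (2 * c\<^sup>2))) \<partial>(lborel :: (real ^ 'n) measure))"
  proof (rule nn_integral_mono)
    fix \<gamma> :: "real ^ 'n"
    show "(\<integral>\<^sup>+\<omega>. ennreal (exp (\<gamma> \<bullet> \<xi> \<omega> - (norm \<gamma>)\<^sup>2 / (2 * \<mu>))) * indicator {\<gamma>. norm \<gamma> \<le> g} \<gamma> \<partial>M)
      \<le> ennreal (exp (- (norm \<gamma>)\<^sup>2 / (2 * c\<^sup>2)))"
    proof (cases "norm \<gamma> \<le> g")
      case True
      have "(\<integral>\<^sup>+\<omega>. ennreal (exp (\<gamma> \<bullet> \<xi> \<omega> - (norm \<gamma>)\<^sup>2 / (2 * \<mu>))) * indicator {\<gamma>. norm \<gamma> \<le> g} \<gamma> \<partial>M)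
        = (\<integral>\<^sup>+\<omega>. ennreal (exp (- (norm \<gamma>)\<^sup>2 / (2 * \<mu>))) * ennreal (exp (\<gamma> \<bullet> \<xi> \<omega>)) \<partial>M)"
        using True by (intro nn_integral_cong) (simp add: ennreal_mult[symmetric] exp_add[symmetric])
      also have "\<dots> = ennreal (exp (- (norm \<gamma>)\<^sup>2 / (2 * \<mu>))) * (\<integral>\<^sup>+\<omega>. ennreal (exp (\<gamma> \<bullet> \<xi> \<omega>)) \<partial>M)"
        by (rule nn_integral_cmult) measurable
      also have "\<dots> \<le> ennreal (exp (- (norm \<gamma>)\<^sup>2 / (2 * \<mu>))) * ennreal (exp ((norm \<gamma>)\<^sup>2 / 2))"
        by (intro mult_left_mono mgf True) auto
      also have "\<dots> = ennreal (exp (- (norm \<gamma>)\<^sup>2 / (2 * \<mu>) + (norm \<gamma>)\<^sup>2 / 2))"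
        by (simp only: exp_add ennreal_mult[OF exp_ge_zero exp_ge_zero])
      also have "- (norm \<gamma>)\<^sup>2 / (2 * \<mu>) + (norm \<gamma>)\<^sup>2 / 2 = - (norm \<gamma>)\<^sup>2 / (2 * c\<^sup>2)"
        using \<mu> unfolding c by (simp add: field_simps)
      finally show ?thesis .
    qed simp
  qed
  also have "\<dots> = ennreal (c ^ CARD('n)) * (\<integral>\<^sup>+x. ennreal (exp (- (norm (c *\<^sub>R x))\<^sup>2 / (2 * c\<^sup>2))) \<partial>(lborel :: (real ^ 'n) measure))"
    using c by (subst nn_integral_lborel_affine[where c = c and t = 0]) auto
  also have "\<dots> = ennreal (c ^ CARD('n)) * (\<integral>\<^sup>+x. ennreal (exp (- (norm x)\<^sup>2 / 2)) \<partial>(lborel :: (real ^ 'n) measure))"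
    using c(1) by (simp add: power_mult_distrib)
  also have "\<dots> \<le> ennreal (c ^ CARD('n)) * (2 * gauss_ball TYPE(real ^ 'n))"
    by (intro mult_left_mono gaussian_integral_le_gauss_ball) auto
  also have "\<dots> = ennreal (2 * c ^ CARD('n)) * gauss_ball TYPE(real ^ 'n)"
    using c by (simp add: ennreal_mult mult_ac)
  finally show ?thesis unfolding c_def .
qed

text \<open>Markov's inequality for \<open>tilt_integral g \<mu> (\<xi> \<omega>)\<close>: the
  centre \<open>b\<close>, chosen separately for each outcome, bounds it from below on
  \<open>A\<close>. The powers of \<open>sqrt \<mu>\<close> cancel, leaving the factor
  \<open>(1 - \<mu>) powr (- CARD('n) / 2)\<close>.\<close>

lemma (in prob_space) prob_le_of_tilt:
  fixes \<xi> :: "'a \<Rightarrow> real ^ 'n" and \<mu> :: real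
  assumes \<xi>[measurable]: "\<xi> \<in> borel_measurable M"
    and bound: "exp_moment_bound g \<xi>" and \<mu>: "0 < \<mu>" "\<mu> < 1"
    and A[measurable]: "A \<in> sets M"
    and b: "\<And>\<omega>. \<omega> \<in> A \<Longrightarrow>
      \<exists>b. norm b + sqrt (\<mu> * CARD('n)) \<le> g \<and> m \<le> b \<bullet> \<xi> \<omega> - (norm b)\<^sup>2 / (2 * \<mu>)"
  shows "prob A \<le> 2 * exp (- m - CARD('n) / 2 * ln (1 - \<mu>))"
proof -
  let ?G = "gauss_ball TYPE(real ^ 'n)"
  let ?s = "sqrt \<mu> ^ CARD('n)"
  have G: "?G > 0" "?G < \<infinity>" by (rule gauss_ball_pos, rule gauss_ball_finite)
  have "ennreal (exp m * ?s * prob A) = ennreal (exp m * ?s) * ennreal (prob A)"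
    using \<mu> by (intro ennreal_mult) auto
  then have "ennreal (exp m * ?s * prob A) * ?G = ennreal (exp m * ?s) * ?G * emeasure M A"
    by (simp add: emeasure_eq_measure ac_simps)
  also have "\<dots> = (\<integral>\<^sup>+\<omega>. ennreal (exp m * ?s) * ?G * indicator A \<omega> \<partial>M)"
    by (rule nn_integral_cmult_indicator[symmetric]) (rule A)
  also have "\<dots> \<le> (\<integral>\<^sup>+\<omega>. tilt_integral g \<mu> (\<xi> \<omega>) \<partial>M)"
  proof (rule nn_integral_mono)
    fix \<omega>
    show "ennreal (exp m * ?s) * ?G * indicator A \<omega> \<le> tilt_integral g \<mu> (\<xi> \<omega>)"
    proof (cases "\<omega> \<in> A")
      case True
      then obtain b where b: "norm b + sqrt (\<mu> * CARD('n)) \<le> g" "m \<le> b \<bullet> \<xi> \<omega> - (norm b)\<^sup>2 / (2 * \<mu>)"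
        using assms(6) by blast
      have "ennreal (exp m * ?s) * ?G \<le> ennreal (exp (b \<bullet> \<xi> \<omega> - (norm b)\<^sup>2 / (2 * \<mu>)) * ?s) * ?G"
        using b \<mu> by (intro mult_right_mono ennreal_leI) auto
      also have "\<dots> \<le> tilt_integral g \<mu> (\<xi> \<omega>)"
        using tilt_integral_lower[of \<mu> b g "\<xi> \<omega>"] \<mu> b by simp
      finally show ?thesis using True by simp
    qed simp
  qed
  also have "\<dots> \<le> ennreal (2 * sqrt (\<mu> / (1 - \<mu>)) ^ CARD('n)) * ?G"
    by (rule nn_integral_tilt_integral_upper[OF \<xi> bound \<mu>])
  \<comment> \<open>The ball mass is positive and finite, so it cancels.\<close>
  finally have "exp m * ?s * prob A \<le> 2 * sqrt (\<mu> / (1 - \<mu>)) ^ CARD('n)"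
    using G \<mu> by (simp add: mult.commute[of _ ?G] ennreal_mult_le_mult_iff ennreal_le_iff)
  also have "sqrt (\<mu> / (1 - \<mu>)) ^ CARD('n) = ?s * exp (- CARD('n) / 2 * ln (1 - \<mu>))"
  proof -
    have "sqrt (1 - \<mu>) = exp (ln (1 - \<mu>) / 2)"
      using \<mu> by (simp add: powr_half_sqrt[symmetric] powr_def)
    then have "sqrt (1 - \<mu>) ^ CARD('n) = exp (CARD('n) / 2 * ln (1 - \<mu>))"
      by (simp add: exp_of_nat_mult[symmetric])
    then show ?thesis
      by (simp add: real_sqrt_divide power_divide exp_minus field_simps)
  qed
  finally have "?s * (exp m * prob A) \<le> ?s * (2 * exp (- CARD('n) / 2 * ln (1 - \<mu>)))"
    by (simp add: mult_ac)
  then have "exp m * prob A \<le> 2 * exp (- CARD('n) / 2 * ln (1 - \<mu>))"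
    using \<mu> by (subst (asm) mult_le_cancel_left_pos) auto
  then have "exp (- m) * (exp m * prob A) \<le> exp (- m) * (2 * exp (- CARD('n) / 2 * ln (1 - \<mu>)))"
    by (rule mult_left_mono) simp
  also have "\<dots> = 2 * exp (- m - CARD('n) / 2 * ln (1 - \<mu>))"
    by (simp add: exp_add[symmetric])
  also have "exp (- m) * (exp m * prob A) = prob A"
    by (simp add: mult.assoc[symmetric] exp_add[symmetric])
  finally show ?thesis .
qed

subsection \<open>Deviation bounds\<close>

text \<open>
  This and the next bound meet at \<open>u = 1\<close>, where they read \<open>1 - ln 2 \<ge> 2 / \<kappa>\<close>: this is the origin of
  the constant 6.6.
\<close>
lemma sub_ln_ge_square:
  fixes u :: real
  assumes "0 \<le> u" "u \<le> 1"
  shows "2 / kappa * u\<^sup>2 \<le> u - ln (1 + u)"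
proof -
  define f where "f u = u - ln (1 + u) - 2 / kappa * u\<^sup>2" for u :: real
  \<comment> \<open>With \<open>2 / kappa = 10 / 33\<close> the derivative changes sign only at
    0.65, from positive to negative. The minimum of \<open>f\<close> over the unit interval is
    therefore at an endpoint, where \<open>f 0 = 0\<close> and
    \<open>f 1 = 1 - ln 2 - 10 / 33\<close>.\<close>
  have f: "(f has_real_derivative u * (0.65 - u) / (1.65 * (1 + u))) (at u)" if "u \<ge> 0" for u
    unfolding f_def kappa_def using that
    by (auto intro!: derivative_eq_intros simp: divide_simps) (auto simp: algebra_simps power2_eq_square)
  have "0 \<le> f u"
  proof (cases "u \<le> 0.65")
    case True
    have "f 0 \<le> f u"
    proof (rule DERIV_nonneg_imp_nondecreasing[OF assms(1)])
      fix t assume t: "0 \<le> t" "t \<le> u"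
      then have "0 \<le> t * (0.65 - t) / (1.65 * (1 + t))" using True by simp
      then show "\<exists>y. (f has_real_derivative y) (at t) \<and> 0 \<le> y"
        using f[OF t(1)] by blast
    qed
    then show ?thesis by (simp add: f_def)
  next
    case False
    have "f 1 \<le> f u"
    proof (rule DERIV_nonpos_imp_nonincreasing[OF assms(2)])
      fix t assume t: "u \<le> t" "t \<le> 1"
      then have "t * (0.65 - t) / (1.65 * (1 + t)) \<le> 0"
        using False by (intro divide_nonpos_nonneg mult_nonneg_nonpos) auto
      moreover have "0 \<le> t" using t assms by linarith
      ultimately show "\<exists>y. (f has_real_derivative y) (at t) \<and> y \<le> 0"
        using f[of t] by blast
    qed
    moreover have "0 \<le> f 1"
      using ln2_le_25_over_36 by (simp add: f_def kappa_def)
    ultimately show ?thesis by linarith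
  qed
  then show ?thesis by (simp add: f_def)
qed

lemma sub_ln_ge_linear:
  fixes u :: real
  assumes "1 \<le> u"
  shows "2 / kappa * u \<le> u - ln (1 + u)"
proof -
  \<comment> \<open>The logarithm is bounded by its tangent at 2, which leaves
    \<open>u / 2 - 7 / 36\<close> as a lower bound; this exceeds \<open>10 / 33 * u\<close> from
    \<open>u = 1\<close> on.\<close>
  have "ln (1 + u) = ln 2 + ln ((1 + u) / 2)"
    using assms by (simp add: ln_div)
  also have "ln ((1 + u) / 2) \<le> (1 + u) / 2 - 1"
    using assms by (intro ln_le_minus_one) simp
  finally have "ln (1 + u) \<le> 25 / 36 + ((1 + u) / 2 - 1)"
    using ln2_le_25_over_36 by linarith
  then have "10 / 33 * u \<le> u - ln (1 + u)" using assms by argo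
  then show ?thesis by (simp add: kappa_def)
qed

section \<open>Identities for the critical quantities\<close>

context
  fixes g :: real and p :: nat
  assumes g: "g > 0" and p: "p \<ge> 1"
begin

lemma w_c_pos: "w_c g p > 0"
  using is_w_c_w_c[OF g p] by (simp add: is_w_c_def)

lemma mu_c_bounds: "0 < mu_c g p" "mu_c g p < 1"
  using w_c_pos by (simp_all add: mu_c_def add_pos_pos)

lemma y_c_pos: "y_c g p > 0"
  using p by (simp add: y_c_def add_pos_nonneg)

text \<open>The equation defining \<open>w_c\<close> in geometric form: for a vector \<xi> of norm
  \<open>y_c\<close>, the ball of radius \<open>sqrt (mu_c g p * p)\<close> around
  \<open>mu_c g p *\<^sub>R \<xi>\<close> just fits into the ball of radius
  \<open>g\<close>.\<close>

lemma mu_c_mult_y_c: "mu_c g p * y_c g p + sqrt (mu_c g p * p) = g"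
proof -
  define w q where "w = w_c g p" and "q = sqrt (1 + w\<^sup>2)"
  have w: "w > 0" "w * (1 + w) / q = g * real p powr (- 1 / 2)"
    using is_w_c_w_c[OF g p] by (simp_all add: is_w_c_def w_def q_def)
  have q: "q > 0" "q\<^sup>2 = 1 + w\<^sup>2" by (simp_all add: q_def add_pos_nonneg)
  have "real p powr (- 1 / 2) = 1 / sqrt (real p)"
    using p powr_minus_divide[of "real p" "1 / 2"] by (simp add: powr_half_sqrt)
  then have "g = w * (1 + w) / q * sqrt p"
    using w p by simp
  moreover have "mu_c g p * y_c g p = w\<^sup>2 / q * sqrt p"
  proof -
    have "mu_c g p * y_c g p = w\<^sup>2 / q\<^sup>2 * (q * sqrt p)"
      by (simp add: mu_c_def y_c_def w_def[symmetric] q(2) real_sqrt_mult) (simp add: q_def)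
    then show ?thesis using q(1) by (simp add: power2_eq_square)
  qed
  moreover have "sqrt (mu_c g p * p) = w / q * sqrt p"
    using w by (simp add: mu_c_def w_def[symmetric] q_def real_sqrt_mult real_sqrt_divide)
  ultimately show ?thesis
    by (simp add: power2_eq_square distrib_left distrib_right add_divide_distrib)
qed

text \<open>Consequently the two choices of the centre, proportional to \<xi> and of fixed length
  \<open>g_c\<close>, agree where the norm of \<xi> is \<open>y_c\<close>.\<close>

lemma g_c_eq_mu_c_mult_y_c: "g_c g p = mu_c g p * y_c g p"
  using mu_c_mult_y_c by (simp add: g_c_def)

lemma g_c_pos: "g_c g p > 0"
  using mu_c_bounds y_c_pos by (simp add: g_c_eq_mu_c_mult_y_c)

lemma g_c_mult_y_c: "g_c g p * y_c g p = p * (w_c g p)\<^sup>2"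
proof -
  have "(y_c g p)\<^sup>2 = (1 + (w_c g p)\<^sup>2) * p" by (simp add: y_c_def add_nonneg_nonneg)
  then have "g_c g p * y_c g p = mu_c g p * ((1 + (w_c g p)\<^sup>2) * p)"
    by (simp add: g_c_eq_mu_c_mult_y_c power2_eq_square mult.assoc)
  moreover have "1 + (w_c g p)\<^sup>2 > 0" by (simp add: add_pos_nonneg)
  ultimately show ?thesis by (simp add: mu_c_def)
qed

end

section \<open>Exponential bounds above and below the critical radius\<close>

text \<open>The centre points along \<xi> with length \<open>g_c\<close>, the largest length that
  \<open>prob_le_of_tilt\<close> admits for \<open>mu_c\<close>. At \<open>d = 0\<close> the
  exponent \<open>m\<close> is half of \<open>g_c g p * y_c g p\<close>, which is the first term of
  \<open>x_c\<close>; the term with \<open>ln (1 - mu_c g p)\<close> supplies the second.\<close>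

lemma (in prob_space) prob_norm_ge_y_c:
  fixes \<xi> :: "'a \<Rightarrow> real ^ 'n" and g d :: real
  assumes \<xi>[measurable]: "\<xi> \<in> borel_measurable M"
    and bound: "exp_moment_bound g \<xi>" and g: "g > 0" and p: "p = CARD('n)" and d: "d \<ge> 0"
  shows "prob {\<omega> \<in> space M. norm (\<xi> \<omega>) \<ge> y_c g p + d} \<le> 2 * exp (- x_c g p - g_c g p * d)"
proof -
  have p1: "p \<ge> 1" using p by (simp add: Suc_leI)
  let ?\<mu> = "mu_c g p"
  note \<mu> = mu_c_bounds[OF g p1] and gc = g_c_pos[OF g p1] and yc = y_c_pos[OF g p1]
  define m where "m = g_c g p * (y_c g p + d) - (g_c g p)\<^sup>2 / (2 * ?\<mu>)"
  have "prob {\<omega> \<in> space M. norm (\<xi> \<omega>) \<ge> y_c g p + d} \<le> 2 * exp (- m - CARD('n) / 2 * ln (1 - ?\<mu>))"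
  proof (rule prob_le_of_tilt[OF \<xi> bound \<mu>])
    fix \<omega> assume "\<omega> \<in> {\<omega> \<in> space M. norm (\<xi> \<omega>) \<ge> y_c g p + d}"
    then have \<omega>: "norm (\<xi> \<omega>) \<ge> y_c g p + d" by simp
    define b where "b = (g_c g p / norm (\<xi> \<omega>)) *\<^sub>R \<xi> \<omega>"
    have \<xi>0: "norm (\<xi> \<omega>) > 0" using \<omega> yc d by linarith
    then have nb: "norm b = g_c g p" using gc by (simp add: b_def)
    have "b \<bullet> \<xi> \<omega> = g_c g p * norm (\<xi> \<omega>)"
      using \<xi>0 by (simp add: b_def power2_norm_eq_inner[symmetric] power2_eq_square)
    then have "m \<le> b \<bullet> \<xi> \<omega> - (norm b)\<^sup>2 / (2 * ?\<mu>)"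
      using \<omega> gc by (simp add: m_def nb)
    moreover have "norm b + sqrt (?\<mu> * CARD('n)) \<le> g"
      using nb p by (simp add: g_c_def)
    ultimately show "\<exists>b. norm b + sqrt (?\<mu> * CARD('n)) \<le> g \<and> m \<le> b \<bullet> \<xi> \<omega> - (norm b)\<^sup>2 / (2 * ?\<mu>)"
      by blast
  qed measurable
  also have "- m - CARD('n) / 2 * ln (1 - ?\<mu>) = - x_c g p - g_c g p * d"
  proof -
    have "(g_c g p)\<^sup>2 / (2 * ?\<mu>) = g_c g p * y_c g p / 2"
      using \<mu> by (simp add: g_c_eq_mu_c_mult_y_c[OF g p1] power2_eq_square)
    then have m: "m = p * (w_c g p)\<^sup>2 / 2 + g_c g p * d"
      using g_c_mult_y_c[OF g p1] by (simp add: m_def distrib_left)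
    have "1 + (w_c g p)\<^sup>2 > 0" by (simp add: add_pos_nonneg)
    then have "1 - ?\<mu> = inverse (1 + (w_c g p)\<^sup>2)"
      by (simp add: mu_c_def field_simps)
    then have "ln (1 - ?\<mu>) = - ln (1 + (w_c g p)\<^sup>2)"
      by (simp add: ln_inverse add_pos_nonneg)
    then show ?thesis
      unfolding m by (simp add: x_c_def p[symmetric] algebra_simps)
  qed
  finally show ?thesis .
qed

text \<open>The centre \<open>\<mu> *\<^sub>R \<xi> \<omega>\<close> maximises
  \<open>b \<bullet> \<xi> \<omega> - (norm b)\<^sup>2 / (2 * \<mu>)\<close>, with maximum
  \<open>\<mu> * (norm (\<xi> \<omega>))\<^sup>2 / 2\<close>. It is admissible because \<mu> is at
  most \<open>mu_c\<close> and the norm of \<xi> at most \<open>y_c\<close>.\<close>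

lemma (in prob_space) prob_sqnorm_ge_bulk:
  fixes \<xi> :: "'a \<Rightarrow> real ^ 'n" and g u :: real
  assumes \<xi>[measurable]: "\<xi> \<in> borel_measurable M"
    and bound: "exp_moment_bound g \<xi>" and g: "g > 0" and p: "p = CARD('n)"
    and u: "0 < u" "u \<le> (w_c g p)\<^sup>2"
  shows "prob {\<omega> \<in> space M. (norm (\<xi> \<omega>))\<^sup>2 \<ge> p * (1 + u) \<and> norm (\<xi> \<omega>) \<le> y_c g p}
    \<le> 2 * exp (- (p / 2 * (u - ln (1 + u))))"
proof -
  have p1: "p \<ge> 1" using p by (simp add: Suc_leI)
  \<comment> \<open>This value minimises the resulting exponent
    \<open>- \<mu> * p * (1 + u) / 2 - p / 2 * ln (1 - \<mu>)\<close>.\<close>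
  define \<mu> where "\<mu> = u / (1 + u)"
  have \<mu>: "0 < \<mu>" "\<mu> < 1" using u by (simp_all add: \<mu>_def)
  have \<mu>_le: "\<mu> \<le> mu_c g p"
    using u by (simp add: \<mu>_def mu_c_def divide_simps add_pos_nonneg) (simp add: algebra_simps)
  have "prob {\<omega> \<in> space M. (norm (\<xi> \<omega>))\<^sup>2 \<ge> p * (1 + u) \<and> norm (\<xi> \<omega>) \<le> y_c g p}
    \<le> 2 * exp (- (p * u / 2) - CARD('n) / 2 * ln (1 - \<mu>))"
  proof (rule prob_le_of_tilt[OF \<xi> bound \<mu>])
    fix \<omega> assume "\<omega> \<in> {\<omega> \<in> space M. (norm (\<xi> \<omega>))\<^sup>2 \<ge> p * (1 + u) \<and> norm (\<xi> \<omega>) \<le> y_c g p}"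
    then have \<omega>: "p * (1 + u) \<le> (norm (\<xi> \<omega>))\<^sup>2" "norm (\<xi> \<omega>) \<le> y_c g p" by auto
    have "norm (\<mu> *\<^sub>R \<xi> \<omega>) + sqrt (\<mu> * CARD('n)) \<le> mu_c g p * y_c g p + sqrt (mu_c g p * p)"
      using \<omega>(2) \<mu> \<mu>_le unfolding p
      by (intro add_mono) (auto intro!: mult_mono mult_right_mono)
    then have "norm (\<mu> *\<^sub>R \<xi> \<omega>) + sqrt (\<mu> * CARD('n)) \<le> g"
      by (simp add: mu_c_mult_y_c[OF g p1])
    moreover have "p * u / 2 \<le> (\<mu> *\<^sub>R \<xi> \<omega>) \<bullet> \<xi> \<omega> - (norm (\<mu> *\<^sub>R \<xi> \<omega>))\<^sup>2 / (2 * \<mu>)"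
    proof -
      have "p * u = \<mu> * (p * (1 + u))" using u by (simp add: \<mu>_def)
      also have "\<dots> \<le> \<mu> * (norm (\<xi> \<omega>))\<^sup>2" using \<omega>(1) \<mu> by (intro mult_left_mono) auto
      also have "\<mu> * (norm (\<xi> \<omega>))\<^sup>2 / 2 = (\<mu> *\<^sub>R \<xi> \<omega>) \<bullet> \<xi> \<omega> - (norm (\<mu> *\<^sub>R \<xi> \<omega>))\<^sup>2 / (2 * \<mu>)"
        using \<mu> by (simp add: power2_norm_eq_inner[symmetric] power_mult_distrib) (simp add: power2_eq_square)
      finally show ?thesis by linarith
    qed
    ultimately show "\<exists>b. norm b + sqrt (\<mu> * CARD('n)) \<le> g \<and> p * u / 2 \<le> b \<bullet> \<xi> \<omega> - (norm b)\<^sup>2 / (2 * \<mu>)"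
      by blast
  qed measurable
  also have "ln (1 - \<mu>) = - ln (1 + u)"
  proof -
    have "1 - \<mu> = inverse (1 + u)" using u by (simp add: \<mu>_def field_simps)
    then show ?thesis using u by (simp add: ln_inverse)
  qed
  also have "- (p * u / 2) - CARD('n) / 2 * - ln (1 + u) = - (p / 2 * (u - ln (1 + u)))"
    by (simp add: p[symmetric] algebra_simps diff_divide_distrib)
  finally show ?thesis .
qed

section \<open>The two quantile bounds\<close>

theorem corollary3p2:
  fixes M :: "'a measure" and \<xi> :: "'a \<Rightarrow> real ^ 'n" and g :: real and p :: nat
  assumes "prob_space M"
    and "\<xi> \<in> borel_measurable M"
    and "p = CARD('n)"
    and "g > 0"
    and "g\<^sup>2 \<ge> real p"
    and "prob_space.exp_moment_bound M g \<xi>"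
  shows "(\<forall>x. 0 \<le> x \<and> x \<le> x_c g p \<longrightarrow>
            measure M {\<omega> \<in> space M. (norm (\<xi> \<omega>))\<^sup>2 \<ge> z_quant x p}
              \<le> 2 * exp (- x) + 8.4 * exp (- x_c g p)) \<and>
         (\<forall>x. x > x_c g p \<longrightarrow>
            measure M {\<omega> \<in> space M. (norm (\<xi> \<omega>))\<^sup>2 \<ge> z_c g x p}
              \<le> 8.4 * exp (- x))"
proof (intro conjI allI impI)
  interpret prob_space M by fact
  note \<xi>[measurable] = assms(2) and p = assms(3) and g = assms(4) and bound = assms(6)
  have p1: "p \<ge> 1" using p by (simp add: Suc_leI)
  note gc = g_c_pos[OF g p1] and yc = y_c_pos[OF g p1]
  {
    fix x assume x: "0 \<le> x \<and> x \<le> x_c g p"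
    let ?A = "{\<omega> \<in> space M. (norm (\<xi> \<omega>))\<^sup>2 \<ge> z_quant x p}"
    \<comment> \<open>Here \<open>u\<close> is the relative excess of the quantile over
      \<open>p\<close>, the form in which the bulk bound is stated.\<close>
    define u where "u = (if x \<le> p / kappa then sqrt (kappa * x / p) else kappa * x / p)"
    have z: "z_quant x p = p * (1 + u)"
    proof (cases "x \<le> p / kappa")
      case True
      have "sqrt (kappa * x * p) = sqrt ((kappa * x / p) * p\<^sup>2)"
        using p1 by (simp add: power2_eq_square)
      also have "\<dots> = p * sqrt (kappa * x / p)"
        by (subst real_sqrt_mult) simp
      finally show ?thesis using True by (simp add: z_quant_def u_def distrib_left)
    next
      case False
      then show ?thesis using p1 by (simp add: z_quant_def u_def distrib_left)
    qed
    have u0: "u \<ge> 0" using x by (simp add: u_def kappa_def)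
    \<comment> \<open>The constant \<open>kappa\<close> enters here: the quadratic and the linear
      bound on \<open>u - ln (1 + u)\<close>, multiplied by \<open>p / 2\<close>, have exactly
      \<open>x\<close> as their smaller side.\<close>
    have ux: "x \<le> p / 2 * (u - ln (1 + u))"
    proof (cases "x \<le> p / kappa")
      case True
      then have "kappa * x / p \<le> 1" using p1 by (simp add: kappa_def field_simps)
      then have "2 / kappa * u\<^sup>2 \<le> u - ln (1 + u)"
        using True u0 by (intro sub_ln_ge_square) (auto simp: u_def)
      then have "p / 2 * (2 / kappa * u\<^sup>2) \<le> p / 2 * (u - ln (1 + u))"
        by (intro mult_left_mono) auto
      moreover have "u\<^sup>2 = kappa * x / p" using True x by (simp add: u_def kappa_def)
      then have "p / 2 * (2 / kappa * u\<^sup>2) = x" using p1 by (simp add: kappa_def)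
      ultimately show ?thesis by linarith
    next
      case False
      then have "2 / kappa * u \<le> u - ln (1 + u)"
        using p1 by (intro sub_ln_ge_linear) (auto simp: u_def kappa_def field_simps)
      then have "p / 2 * (2 / kappa * u) \<le> p / 2 * (u - ln (1 + u))"
        by (intro mult_left_mono) auto
      moreover have "p / 2 * (2 / kappa * u) = x" using False p1 by (simp add: u_def kappa_def)
      ultimately show ?thesis by linarith
    qed
    have tail: "prob {\<omega> \<in> space M. norm (\<xi> \<omega>) \<ge> y_c g p} \<le> 2 * exp (- x_c g p)"
      using prob_norm_ge_y_c[OF \<xi> bound g p order_refl] by simp
    have yc2: "(y_c g p)\<^sup>2 = p * (1 + (w_c g p)\<^sup>2)"
      by (simp add: y_c_def add_nonneg_nonneg mult.commute)
    \<comment> \<open>For \<open>u = 0\<close> the right-hand side exceeds 1. For \<open>u\<close>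
      up to \<open>w_c\<close> squared the event is split at norm \<open>y_c\<close> into a bulk and
      a tail part. For larger \<open>u\<close> the quantile is beyond \<open>y_c\<close> squared and
      the tail bound alone suffices.\<close>
    consider "u = 0" | "0 < u" "u \<le> (w_c g p)\<^sup>2" | "u > (w_c g p)\<^sup>2" using u0 by linarith
    then show "prob ?A \<le> 2 * exp (- x) + 8.4 * exp (- x_c g p)"
    proof cases
      case 1
      then have "x = 0" using ux x by simp
      then have "2 * exp (- x) = 2" by simp
      then show ?thesis
        using prob_le_1[of ?A] exp_gt_zero[of "- x_c g p"] by linarith
    next
      case 2
      let ?B = "{\<omega> \<in> space M. (norm (\<xi> \<omega>))\<^sup>2 \<ge> p * (1 + u) \<and> norm (\<xi> \<omega>) \<le> y_c g p}"
      let ?C = "{\<omega> \<in> space M. norm (\<xi> \<omega>) \<ge> y_c g p}"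
      have "prob ?A \<le> prob (?B \<union> ?C)"
        unfolding z by (rule finite_measure_mono) auto
      also have "\<dots> \<le> prob ?B + prob ?C"
        by (rule measure_Un_le) measurable
      also have "prob ?B \<le> 2 * exp (- (p / 2 * (u - ln (1 + u))))"
        by (rule prob_sqnorm_ge_bulk[OF \<xi> bound g p 2])
      also have "\<dots> \<le> 2 * exp (- x)" using ux by simp
      finally show ?thesis using tail exp_gt_zero[of "- x_c g p"] by linarith
    next
      case 3
      have "prob ?A \<le> prob {\<omega> \<in> space M. norm (\<xi> \<omega>) \<ge> y_c g p}"
      proof (rule finite_measure_mono)
        have "(y_c g p)\<^sup>2 \<le> z_quant x p" unfolding z yc2 using 3 by (intro mult_left_mono) auto
        then show "?A \<subseteq> {\<omega> \<in> space M. norm (\<xi> \<omega>) \<ge> y_c g p}"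
          by (auto intro: power2_le_imp_le order_trans)
      qed measurable
      then show ?thesis using tail exp_gt_zero[of "- x"] exp_gt_zero[of "- x_c g p"] by linarith
    qed
  }
  {
    fix x assume x: "x > x_c g p"
    define d where "d = 2 * (x - x_c g p) / g_c g p"
    have d: "d \<ge> 0" using x gc by (simp add: d_def)
    have "z_c g x p \<le> (norm (\<xi> \<omega>))\<^sup>2 \<longleftrightarrow> y_c g p + d \<le> norm (\<xi> \<omega>)" for \<omega>
      using yc d abs_le_square_iff[of "y_c g p + d" "norm (\<xi> \<omega>)"] by (simp add: z_c_def d_def)
    then have "prob {\<omega> \<in> space M. (norm (\<xi> \<omega>))\<^sup>2 \<ge> z_c g x p} \<le> 2 * exp (- x_c g p - g_c g p * d)"
      using prob_norm_ge_y_c[OF \<xi> bound g p d] by simp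
    \<comment> \<open>The factor 2 in \<open>z_c\<close> makes the exponent decrease at twice the
      rate of \<open>x\<close>; the surplus \<open>x - x_c g p\<close> is dropped next.\<close>
    also have "- x_c g p - g_c g p * d = - x - (x - x_c g p)" using gc by (simp add: d_def)
    also have "2 * exp (- x - (x - x_c g p)) \<le> 2 * exp (- x)" using x by simp
    also have "\<dots> \<le> 8.4 * exp (- x)" by simp
    finally show "prob {\<omega> \<in> space M. (norm (\<xi> \<omega>))\<^sup>2 \<ge> z_c g x p} \<le> 8.4 * exp (- x)" .
  }
qed

end
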